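(* Let $X$ be a Banach space and let $Z$ be a spreading model of $X$ with fundamental sequence $(e_n)_n$. Let $T$ be the shift of $Z$. The following assertions are equivalent: (i) the restriction of $T$ to $\overline{\mathrm{co}}\{e_n\}_n$ has a fixed point; (ii) $(e_n)_n$ is weakly convergent.
   Context: Banach spaces are real; $\overline{\mathrm{co}}$ denotes the closed convex hull. Spreading models: a sequence $(x_n)_n$ in $X$ is good if for all $k\in\mathbb N$ and $a_1,\dots,a_k\in\mathbb R$ the limit $\lim_{n_1\to\infty}\|a_1x_{n_1}+\dots+a_kx_{n_k}\|$ (over $n_1<\dots<n_k$) exists. If $(x_n)_n$ is a bounded good sequence that is not convergent, then $\|(a_1,\dots,a_k)\|=\lim_{n_1\to\infty}\|a_1x_{n_1}+\dots+a_kx_{n_k}\|$ ($n_1<\dots<n_k$) defines a norm on $c_{00}$, and the completion $Z$ of $c_{00}$ for this norm is called the spreading model of $X$ built on $(x_n)_n$. Its fundamental sequence $(e_n)_n$ is the canonical basis of $c_{00}$. It is spreading: $\|\sum_{i=1}^k a_ie_i\|=\|\sum_{i=1}^k a_ie_{n_i}\|$ for all scalars and all $n_1<\dots<n_k$. The shift of $Z$ is the linear isometry $T:Z\to Z$ extending $T\left(\sum_{i\ge1}a_ie_i\right)=\sum_{i\ge2}a_{i-1}e_i$ (on $c_{00}$); it maps $\overline{\mathrm{co}}\{e_n\}_n$ into itself. *)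

theory Defs
  imports "HOL-Analysis.Analysis"
begin

text \<open>
  Sequences and tuples are indexed from 0.  A tuple \<open>n\<^sub>1 < \<dots> < n\<^sub>k\<close> is encoded by the values
  \<open>n 0 < \<dots> < n (k - 1)\<close> of a function whose other values are irrelevant; convergence along the
  following filter is the limit as \<open>n\<^sub>1 \<rightarrow> \<infinity>\<close> over all such tuples.
\<close>

definition increasing_tuples :: "nat \<Rightarrow> (nat \<Rightarrow> nat) filter" where
  "increasing_tuples k =
     (INF N. principal {n. strict_mono_on {..<k} n \<and> (\<forall>i<k. N \<le> n i)})"

definition good_seq :: "(nat \<Rightarrow> 'a::real_normed_vector) \<Rightarrow> bool" where
  "good_seq x \<longleftrightarrow>
     (\<forall>(k::nat) (a::nat \<Rightarrow> real). \<exists>L.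
        ((\<lambda>n. norm (\<Sum>i<k. a i *\<^sub>R x (n i))) \<longlongrightarrow> L) (increasing_tuples k))"

text \<open>The norm of \<open>(a 0, \<dots>, a (k - 1), 0, 0, \<dots>) \<in> c\<^sub>0\<^sub>0\<close>.\<close>

definition spreading_norm ::
    "(nat \<Rightarrow> 'a::real_normed_vector) \<Rightarrow> nat \<Rightarrow> (nat \<Rightarrow> real) \<Rightarrow> real" where
  "spreading_norm x k a =
     Lim (increasing_tuples k) (\<lambda>n. norm (\<Sum>i<k. a i *\<^sub>R x (n i)))"

text \<open>
  The completion of \<open>c\<^sub>0\<^sub>0\<close> is any Banach space \<open>'z\<close> containing an isometric linear copy of
  \<open>c\<^sub>0\<^sub>0\<close> as a dense subspace.  The embedding is recorded by the images \<open>e n\<close> of the canonical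
  basis; it is injective because \<open>spreading_norm x\<close> is a norm for bounded, good, non-convergent \<open>x\<close>.
\<close>

definition is_spreading_model ::
    "(nat \<Rightarrow> 'a::banach) \<Rightarrow> (nat \<Rightarrow> 'z::banach) \<Rightarrow> bool" where
  "is_spreading_model x e \<longleftrightarrow>
     bounded (range x) \<and> good_seq x \<and> \<not> convergent x \<and>
     (\<forall>k a. norm (\<Sum>i<k. a i *\<^sub>R e i) = spreading_norm x k a) \<and>
     closure (span (range e)) = UNIV"

text \<open>For a spreading model there is exactly one such \<open>T\<close>, because \<open>e\<close> is spreading and its span
  is dense.\<close>

definition is_shift :: "(nat \<Rightarrow> 'z::real_normed_vector) \<Rightarrow> ('z \<Rightarrow> 'z) \<Rightarrow> bool" where
  "is_shift e T \<longleftrightarrow>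
     linear T \<and> (\<forall>z. norm (T z) = norm z) \<and>
     (\<forall>k a. T (\<Sum>i<k. a i *\<^sub>R e i) = (\<Sum>i=1..k. a (i - 1) *\<^sub>R e i))"

definition weakly_convergent :: "(nat \<Rightarrow> 'z::real_normed_vector) \<Rightarrow> bool" where
  "weakly_convergent u \<longleftrightarrow>
     (\<exists>l. \<forall>f :: 'z \<Rightarrow>\<^sub>L real. (\<lambda>n. blinfun_apply f (u n)) \<longlonglongrightarrow> blinfun_apply f l)"

end

theory Submission
  imports Defs
begin

text \<open>
  If \<open>z\<close> is fixed by \<open>T\<close> and \<open>y = \<Sum>i<k. a i *\<^sub>R e i\<close> is a convex combination within \<open>\<epsilon>\<close> of \<open>z\<close>, then
  so is every \<open>T\<^sup>m y\<close>.  For indices \<open>n 0 < n 1 < \<dots>\<close> and \<open>m\<close> large, the difference of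
  \<open>y' = \<Sum>i<k. a i *\<^sub>R e (n i)\<close> and \<open>T\<^sup>m y\<close> has, as \<open>e\<close> is spreading, the norm of \<open>y - T\<^sup>k y\<close>, which is
  below \<open>2\<epsilon>\<close>; hence \<open>y'\<close> is within \<open>3\<epsilon>\<close> of \<open>z\<close>.  So no functional can stay away from its value
  at \<open>z\<close> along a subsequence of \<open>e\<close>, and \<open>e\<close> converges weakly to \<open>z\<close>.  Conversely, a weak limit of
  \<open>e\<close> is fixed by \<open>T\<close> and lies in the closed convex hull by Mazur's theorem.
\<close>

section \<open>Hahn-Banach separation\<close>

definition sublinear :: "('a::real_vector \<Rightarrow> real) \<Rightarrow> bool" where
  "sublinear p \<longleftrightarrow> (\<forall>x y. p (x + y) \<le> p x + p y) \<and> (\<forall>c>0. \<forall>x. p (c *\<^sub>R x) \<le> c * p x)"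

lemma sublinearI:
  assumes "\<And>x y. p (x + y) \<le> p x + p y" "\<And>c x. c > 0 \<Longrightarrow> p (c *\<^sub>R x) \<le> c * p x"
  shows "sublinear p"
  using assms by (simp add: sublinear_def)

lemma sublinear_add: "sublinear p \<Longrightarrow> p (x + y) \<le> p x + p y"
  by (simp add: sublinear_def)

lemma sublinear_scale_le: "sublinear p \<Longrightarrow> c > 0 \<Longrightarrow> p (c *\<^sub>R x) \<le> c * p x"
  by (simp add: sublinear_def)

lemma sublinear_scale:
  assumes "sublinear p" "c > 0"
  shows "p (c *\<^sub>R x) = c * p x"
proof (rule antisym)
  show "p (c *\<^sub>R x) \<le> c * p x"
    using assms by (rule sublinear_scale_le)
  have "p (inverse c *\<^sub>R c *\<^sub>R x) \<le> inverse c * p (c *\<^sub>R x)"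
    using assms by (intro sublinear_scale_le) auto
  then have "p x \<le> inverse c * p (c *\<^sub>R x)"
    using assms by simp
  then show "c * p x \<le> p (c *\<^sub>R x)"
    using assms by (simp add: field_simps)
qed

lemma sublinear_zero:
  assumes "sublinear p"
  shows "p 0 = 0"
  using sublinear_scale[OF assms, of 2 0] by simp

lemma sublinear_ge:
  assumes "sublinear p"
  shows "- p (- x) \<le> p x"
  using sublinear_add[OF assms, of x "- x"] sublinear_zero[OF assms] by simp

text \<open>For arbitrary families the infimum need not be subadditive. In a chain, the functionals
  \<open>q\<close> used at \<open>x\<close> and \<open>r\<close> used at \<open>y\<close> can both
  be replaced by the smaller of the two.\<close>

lemma sublinear_INF_chain:
  assumes "C \<noteq> {}" and sub: "\<And>q. q \<in> C \<Longrightarrow> sublinear q"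
    and bdd: "\<And>x. bdd_below ((\<lambda>q. q x) ` C)"
    and chain: "\<And>q r. q \<in> C \<Longrightarrow> r \<in> C \<Longrightarrow> q \<le> r \<or> r \<le> q"
  shows "sublinear (\<lambda>x. INF q\<in>C. q x)"
proof (rule sublinearI)
  let ?u = "\<lambda>x. INF q\<in>C. q x"
  have low: "?u x \<le> q x" if "q \<in> C" for q x
    using bdd that by (rule cINF_lower)
  fix x y
  have "?u (x + y) \<le> q x + r y" if qr: "q \<in> C" "r \<in> C" for q r
  proof -
    obtain s where "s \<in> C" "s \<le> q" "s \<le> r"
      using chain[OF qr] qr by blast
    then show ?thesis
      using low[of s "x + y"] sublinear_add[OF sub, of s x y] le_funD[of s q x] le_funD[of s r y]
      by simp
  qed
  then have "?u (x + y) - r y \<le> ?u x" if "r \<in> C" for r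
    using that \<open>C \<noteq> {}\<close> by (intro cINF_greatest) (auto simp: algebra_simps)
  then have "?u (x + y) - ?u x \<le> ?u y"
    using \<open>C \<noteq> {}\<close> by (intro cINF_greatest) (auto simp: algebra_simps)
  then show "?u (x + y) \<le> ?u x + ?u y"
    by simp
next
  let ?u = "\<lambda>x. INF q\<in>C. q x"
  fix c :: real and x
  assume "c > 0"
  have "?u (c *\<^sub>R x) / c \<le> ?u x"
  proof (rule cINF_greatest)
    fix q assume "q \<in> C"
    then have "?u (c *\<^sub>R x) \<le> c * q x"
      using cINF_lower[OF bdd, of q "c *\<^sub>R x"] sublinear_scale_le[OF sub \<open>c > 0\<close>, of q x] by simp
    then show "?u (c *\<^sub>R x) / c \<le> q x"
      using \<open>c > 0\<close> by (simp add: field_simps)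
  qed fact
  then show "?u (c *\<^sub>R x) \<le> c * ?u x"
    using \<open>c > 0\<close> by (simp add: field_simps)
qed

text \<open>Zorn's lemma, with the pointwise infimum as the lower bound of a chain. The infimum is
  finite because \<open>q \<le> p\<close> forces
  \<open>q x \<ge> - q (- x) \<ge> - p (- x)\<close>.\<close>

lemma minimal_sublinear_exists:
  assumes "sublinear p"
  obtains q where "sublinear q" "q \<le> p" "\<And>r. sublinear r \<Longrightarrow> r \<le> q \<Longrightarrow> r = q"
proof -
  define A where "A = {q. sublinear q \<and> q \<le> p}"
  have "\<exists>m\<in>A. \<forall>a\<in>A. a \<le> m \<longrightarrow> a = m"
  \<comment> \<open>The order is reversed, so that the maximal element supplied by Zorn's lemma is a
    minimal functional.\<close>
  proof (rule predicate_Zorn)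
    show "partial_order_on A (relation_of (\<lambda>q r. r \<le> q) A)"
      by (rule partial_order_on_relation_ofI) auto
  next
    fix C assume "C \<in> Chains (relation_of (\<lambda>q r. r \<le> q) A)"
    then have CA: "C \<subseteq> A" and chain: "\<And>q r. q \<in> C \<Longrightarrow> r \<in> C \<Longrightarrow> q \<le> r \<or> r \<le> q"
      by (auto simp: Chains_def relation_of_def)
    show "\<exists>u\<in>A. \<forall>a\<in>C. u \<le> a"
    proof (cases "C = {}")
      case True
      then show ?thesis
        using assms by (auto simp: A_def)
    next
      case False
      then obtain q0 where q0: "q0 \<in> C"
        by blast
      let ?u = "\<lambda>x. INF q\<in>C. q x"
      have bdd: "bdd_below ((\<lambda>q. q x) ` C)" for x
      proof (rule bdd_belowI2)
        fix q assume "q \<in> C"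
        then have "sublinear q" "q (- x) \<le> p (- x)"
          using CA by (auto simp: A_def le_fun_def)
        then show "- p (- x) \<le> q x"
          using sublinear_ge[of q x] by simp
      qed
      have low: "\<forall>q\<in>C. ?u \<le> q"
        using cINF_lower[OF bdd] by (auto simp: le_fun_def)
      moreover have "?u \<le> p"
        using low q0 CA by (auto simp: A_def intro: order_trans)
      moreover have "sublinear ?u"
        using False CA bdd chain by (intro sublinear_INF_chain) (auto simp: A_def)
      ultimately show ?thesis
        by (intro bexI[of _ ?u]) (auto simp: A_def)
    qed
  qed
  then obtain q where q: "q \<in> A" and min: "\<And>r. r \<in> A \<Longrightarrow> r \<le> q \<Longrightarrow> r = q"
    by blast
  show ?thesis
  proof (rule that[of q])
    fix r assume "sublinear r" "r \<le> q"
    then have "r \<in> A"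
      using q by (auto simp: A_def intro: order_trans)
    then show "r = q"
      using min \<open>r \<le> q\<close> by blast
  qed (use q in \<open>simp_all add: A_def\<close>)
qed

text \<open>The parameters add up: \<open>s\<close> for \<open>u\<close> and \<open>t\<close> for
  \<open>v\<close> combine to \<open>s + t\<close> for \<open>u + v\<close>, which gives
  subadditivity. The choice \<open>t = 0\<close> yields \<open>r \<le> q\<close>, and
  \<open>t = 1\<close> yields \<open>r (- y) \<le> - q y\<close>, so \<open>r\<close> is a
  competitor of \<open>q\<close> that is linear along \<open>y\<close>.\<close>

lemma sublinear_INF_ray:
  fixes y :: "'a::real_vector"
  assumes "sublinear q"
  defines "r \<equiv> \<lambda>x. INF t\<in>{0..}. q (x + t *\<^sub>R y) - t * q y"
  shows "sublinear r" and "0 \<le> t \<Longrightarrow> r x \<le> q (x + t *\<^sub>R y) - t * q y"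
proof -
  have bdd: "bdd_below ((\<lambda>t. q (x + t *\<^sub>R y) - t * q y) ` {0..})" for x
  proof (rule bdd_belowI2)
    fix t :: real assume "t \<in> {0..}"
    then have "q (t *\<^sub>R y) = t * q y"
      using sublinear_scale[OF assms(1), of t y] sublinear_zero[OF assms(1)]
      by (cases "t = 0") auto
    then show "- q (- x) \<le> q (x + t *\<^sub>R y) - t * q y"
      using sublinear_add[OF assms(1), of "x + t *\<^sub>R y" "- x"] by simp
  qed
  have low: "r x \<le> q (x + t *\<^sub>R y) - t * q y" if "0 \<le> t" for t x
    unfolding r_def using bdd that by (intro cINF_lower) auto
  have great: "b \<le> r x" if "\<And>t. 0 \<le> t \<Longrightarrow> b \<le> q (x + t *\<^sub>R y) - t * q y" for b x
    unfolding r_def using that by (intro cINF_greatest) auto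
  show "0 \<le> t \<Longrightarrow> r x \<le> q (x + t *\<^sub>R y) - t * q y"
    by (rule low)
  show "sublinear r"
  proof (rule sublinearI)
    fix u v
    have *: "r (u + v) \<le> (q (u + s *\<^sub>R y) - s * q y) + (q (v + t *\<^sub>R y) - t * q y)"
      if "0 \<le> s" "0 \<le> t" for s t
    proof -
      have "(u + v) + (s + t) *\<^sub>R y = (u + s *\<^sub>R y) + (v + t *\<^sub>R y)"
        by (simp add: algebra_simps)
      then show ?thesis
        using low[of "s + t" "u + v"] that
          sublinear_add[OF assms(1), of "u + s *\<^sub>R y" "v + t *\<^sub>R y"]
        by (simp add: algebra_simps)
    qed
    \<comment> \<open>The two infima are taken one after the other: first over \<open>s\<close> with
      \<open>t\<close> fixed, then over \<open>t\<close>.\<close>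
    have "r (u + v) - (q (v + t *\<^sub>R y) - t * q y) \<le> r u" if "0 \<le> t" for t
      by (rule great) (use *[OF _ that] in \<open>simp add: algebra_simps\<close>)
    then have "r (u + v) - r u \<le> r v"
      by (intro great) (simp add: algebra_simps)
    then show "r (u + v) \<le> r u + r v"
      by simp
  next
    fix c :: real and u
    assume "c > 0"
    have "r (c *\<^sub>R u) / c \<le> r u"
    proof (rule great)
      fix t :: real assume "0 \<le> t"
      then have "r (c *\<^sub>R u) \<le> q (c *\<^sub>R u + (c * t) *\<^sub>R y) - (c * t) * q y"
        using \<open>c > 0\<close> by (intro low) auto
      also have "c *\<^sub>R u + (c * t) *\<^sub>R y = c *\<^sub>R (u + t *\<^sub>R y)"
        by (simp add: algebra_simps)
      finally have "r (c *\<^sub>R u) \<le> c * (q (u + t *\<^sub>R y) - t * q y)"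
        by (simp only: sublinear_scale[OF assms(1) \<open>c > 0\<close>] right_diff_distrib mult.assoc)
      then show "r (c *\<^sub>R u) / c \<le> q (u + t *\<^sub>R y) - t * q y"
        using \<open>c > 0\<close> by (simp add: field_simps)
    qed
    then show "r (c *\<^sub>R u) \<le> c * r u"
      using \<open>c > 0\<close> by (simp add: field_simps)
  qed
qed

lemma minimal_sublinear_linear:
  assumes "sublinear q" and min: "\<And>r. sublinear r \<Longrightarrow> r \<le> q \<Longrightarrow> r = q"
  shows "linear q"
proof -
  have add: "q (x + y) = q x + q y" for x y
  proof (rule antisym)
    \<comment> \<open>Linearising \<open>q\<close> in the direction \<open>y\<close> cannot lower it, as \<open>q\<close> is minimal.\<close>
    define r where "r = (\<lambda>x. INF t\<in>{0..}. q (x + t *\<^sub>R y) - t * q y)"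
    have "r \<le> q"
      using sublinear_INF_ray(2)[OF assms(1), of 0 _ y] by (simp add: r_def le_fun_def)
    then have "r = q"
      using sublinear_INF_ray(1)[OF assms(1), of y] by (intro min) (simp_all add: r_def)
    moreover have "r x \<le> q (x + y) - q y"
      using sublinear_INF_ray(2)[OF assms(1), of 1 x y] by (simp add: r_def)
    ultimately show "q x + q y \<le> q (x + y)"
      by simp
  qed (rule sublinear_add[OF assms(1)])
  have neg: "q (- x) = - q x" for x
    using add[of x "- x"] sublinear_zero[OF assms(1)] by simp
  have "q (c *\<^sub>R x) = c *\<^sub>R q x" for c x
  proof (cases c "0 :: real" rule: linorder_cases)
    case less
    then show ?thesis
      using sublinear_scale[OF assms(1), of "- c" x] neg[of "c *\<^sub>R x"] by simp
  qed (use sublinear_scale[OF assms(1)] sublinear_zero[OF assms(1)] in auto)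
  then show ?thesis
    using add by (intro linearI)
qed

text \<open>A minimal sublinear functional below \<open>p\<close> is already linear. No functional
  on a subspace is extended here; the data of a separation problem are encoded in \<open>p\<close>
  instead.\<close>

theorem Hahn_Banach_sublinear:
  assumes "sublinear p"
  obtains f where "linear f" "\<And>x. f x \<le> p x"
proof -
  obtain q where "sublinear q" "q \<le> p" "\<And>r. sublinear r \<Longrightarrow> r \<le> q \<Longrightarrow> r = q"
    using minimal_sublinear_exists[OF assms] by blast
  then show ?thesis
    using that[of q] minimal_sublinear_linear[of q] by (simp add: le_fun_def)
qed

section \<open>Separation of a point from a convex set, and Mazur's theorem\<close>

theorem separate_point_convex:
  fixes l :: "'a::real_normed_vector"
  assumes "convex C" "C \<noteq> {}" "d \<ge> 0" and dist: "\<And>c. c \<in> C \<Longrightarrow> d \<le> norm (c - l)"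
  obtains f :: "'a \<Rightarrow>\<^sub>L real" where "\<And>c. c \<in> C \<Longrightarrow> f l + d \<le> f c"
proof -
  \<comment> \<open>The choice \<open>x = l - c\<close>, \<open>t = 1\<close> gives \<open>p (l - c) \<le> - d\<close>, so any linear \<open>f \<le> p\<close> separates.\<close>
  let ?g = "\<lambda>x (t, c). norm (x + t *\<^sub>R (c - l)) - t * d"
  define p where "p = (\<lambda>x. INF tc\<in>{0..} \<times> C. ?g x tc)"
  have bdd: "bdd_below (?g x ` ({0..} \<times> C))" for x
  proof (rule bdd_belowI2)
    fix tc :: "real \<times> 'a" assume "tc \<in> {0..} \<times> C"
    then obtain t :: real and c where tc: "tc = (t, c)" "0 \<le> t" "c \<in> C"
      by auto
    \<comment> \<open>The distance hypothesis enters here: it keeps the infimum defining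
      \<open>p\<close> finite.\<close>
    then have "t * d \<le> norm (t *\<^sub>R (c - l))"
      using dist by (simp add: mult_left_mono)
    then show "- norm x \<le> ?g x tc"
      using norm_triangle_ineq4[of "x + t *\<^sub>R (c - l)" x] by (simp add: tc)
  qed
  have low: "p x \<le> norm (x + t *\<^sub>R (c - l)) - t * d" if "0 \<le> t" "c \<in> C" for x t c
    unfolding p_def using cINF_lower[OF bdd, of "(t, c)" x] that by simp
  have great: "b \<le> p x"
    if "\<And>t c. 0 \<le> t \<Longrightarrow> c \<in> C \<Longrightarrow> b \<le> norm (x + t *\<^sub>R (c - l)) - t * d" for b x
    unfolding p_def using that \<open>C \<noteq> {}\<close> by (intro cINF_greatest) auto
  have "sublinear p"
  proof (rule sublinearI)
    fix u v
    have *: "p (u + v) \<le> (norm (u + s *\<^sub>R (a - l)) - s * d) + (norm (v + t *\<^sub>R (b - l)) - t * d)"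
      if "0 \<le> s" "a \<in> C" "0 \<le> t" "b \<in> C" for s t a b
    proof (cases "s + t = 0")
      case True
      then have "s = 0" "t = 0"
        using that by auto
      then show ?thesis
        using low[of 0 a "u + v"] that norm_triangle_ineq[of u v] by simp
    next
      case False
      \<comment> \<open>Convexity merges the pairs \<open>(s, a)\<close> and \<open>(t, b)\<close>
        into the single pair \<open>(s + t, c)\<close>.\<close>
      define c where "c = (s / (s + t)) *\<^sub>R a + (t / (s + t)) *\<^sub>R b"
      have "c \<in> C"
        unfolding c_def using that False \<open>convex C\<close>
        by (intro convexD) (auto simp flip: add_divide_distrib)
      have "(s + t) *\<^sub>R c = s *\<^sub>R a + t *\<^sub>R b"
        using False by (simp add: c_def scaleR_add_right)
      then have "(u + v) + (s + t) *\<^sub>R (c - l) = (u + s *\<^sub>R (a - l)) + (v + t *\<^sub>R (b - l))"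
        by (simp add: algebra_simps)
      then show ?thesis
        using low[of "s + t" c "u + v"] that \<open>c \<in> C\<close>
          norm_triangle_ineq[of "u + s *\<^sub>R (a - l)" "v + t *\<^sub>R (b - l)"]
        by (simp add: algebra_simps)
    qed
    have "p (u + v) - (norm (v + t *\<^sub>R (b - l)) - t * d) \<le> p u" if "0 \<le> t" "b \<in> C" for t b
      by (rule great) (use *[OF _ _ that] in \<open>simp add: algebra_simps\<close>)
    then have "p (u + v) - p u \<le> p v"
      by (intro great) (simp add: algebra_simps)
    then show "p (u + v) \<le> p u + p v"
      by simp
  next
    fix k :: real and u
    assume "k > 0"
    have "p (k *\<^sub>R u) / k \<le> p u"
    proof (rule great)
      fix t :: real and c assume "0 \<le> t" "c \<in> C"
      then have "p (k *\<^sub>R u) \<le> norm (k *\<^sub>R u + (k * t) *\<^sub>R (c - l)) - (k * t) * d"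
        using \<open>k > 0\<close> by (intro low) auto
      also have "k *\<^sub>R u + (k * t) *\<^sub>R (c - l) = k *\<^sub>R (u + t *\<^sub>R (c - l))"
        by (simp add: algebra_simps)
      finally have "p (k *\<^sub>R u) \<le> k * (norm (u + t *\<^sub>R (c - l)) - t * d)"
        using \<open>k > 0\<close> by (simp add: right_diff_distrib)
      then show "p (k *\<^sub>R u) / k \<le> norm (u + t *\<^sub>R (c - l)) - t * d"
        using \<open>k > 0\<close> by (simp add: field_simps)
    qed
    then show "p (k *\<^sub>R u) \<le> k * p u"
      using \<open>k > 0\<close> by (simp add: field_simps)
  qed
  then obtain f where "linear f" and fp: "\<And>x. f x \<le> p x"
    using Hahn_Banach_sublinear by blast
  \<comment> \<open>The choice \<open>t = 0\<close> gives \<open>p \<le> norm\<close>; applied to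
    \<open>x\<close> and \<open>- x\<close> this makes \<open>f\<close> continuous.\<close>
  have "f x \<le> norm x" for x
    using fp[of x] low[of 0 _ x] \<open>C \<noteq> {}\<close> by fastforce
  then have "norm (f x) \<le> norm x * 1" for x
    using linear_neg[OF \<open>linear f\<close>, of x] by (smt (verit) norm_minus_cancel real_norm_def)
  then have "bounded_linear f"
    using \<open>linear f\<close> unfolding bounded_linear_def bounded_linear_axioms_def by blast
  moreover have "f l + d \<le> f c" if "c \<in> C" for c
  proof -
    have "f (l - c) \<le> - d"
      using fp[of "l - c"] low[of 1 c "l - c"] that by simp
    then show ?thesis
      using linear_diff[OF \<open>linear f\<close>] by simp
  qed
  ultimately show ?thesis
    using that[of "Blinfun f"] by (simp add: bounded_linear_Blinfun_apply)
qed

lemma blinfun_separates_points: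
  fixes u v :: "'a::real_normed_vector"
  assumes "\<And>f :: 'a \<Rightarrow>\<^sub>L real. f u = f v"
  shows "u = v"
proof (rule ccontr)
  assume "u \<noteq> v"
  obtain f :: "'a \<Rightarrow>\<^sub>L real" where "f v + norm (u - v) \<le> f u"
    using separate_point_convex[of "{u}" "norm (u - v)" v] by auto
  then show False
    using assms[of f] \<open>u \<noteq> v\<close> by simp
qed

text \<open>A point outside the closure has a positive distance \<open>d\<close> from the hull. A
  separating functional then stays at least \<open>d\<close> above \<open>f l\<close> on every
  \<open>u n\<close>, against weak convergence.\<close>

theorem Mazur_weak_limit:
  fixes u :: "nat \<Rightarrow> 'a::real_normed_vector"
  assumes "\<And>f :: 'a \<Rightarrow>\<^sub>L real. (\<lambda>n. f (u n)) \<longlonglongrightarrow> f l"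
  shows "l \<in> closure (convex hull (range u))"
proof (rule ccontr)
  assume "l \<notin> closure (convex hull (range u))"
  then obtain d where "d > 0" and d: "\<And>c. c \<in> convex hull (range u) \<Longrightarrow> d \<le> norm (c - l)"
    by (force simp: closure_approachable dist_norm not_less)
  obtain f :: "'a \<Rightarrow>\<^sub>L real" where f: "\<And>c. c \<in> convex hull (range u) \<Longrightarrow> f l + d \<le> f c"
    using separate_point_convex[OF convex_convex_hull _ _ d] \<open>d > 0\<close>
    by (metis convex_hull_eq_empty empty_not_UNIV image_is_empty less_imp_le)
  have "f l + d \<le> f (u n)" for n
    by (intro f hull_inc) simp
  then have "f l + d \<le> f l"
    using LIMSEQ_le_const[OF assms[of f]] by blast
  then show False
    using \<open>d > 0\<close> by simp
qed

section \<open>Spreading sequences\<close>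

lemma eventually_increasing_tuples:
  "eventually P (increasing_tuples k) \<longleftrightarrow>
     (\<exists>N. \<forall>n. strict_mono_on {..<k} n \<and> (\<forall>i<k. N \<le> n i) \<longrightarrow> P n)"
  unfolding increasing_tuples_def
proof (subst eventually_INF_base)
  fix M N :: nat
  show "\<exists>K\<in>UNIV. principal {n. strict_mono_on {..<k} n \<and> (\<forall>i<k. K \<le> n i)} \<le>
      inf (principal {n. strict_mono_on {..<k} n \<and> (\<forall>i<k. M \<le> n i)})
        (principal {n. strict_mono_on {..<k} n \<and> (\<forall>i<k. N \<le> n i)})"
    by (intro bexI[of _ "max M N"]) auto
qed (auto simp: eventually_principal)

text \<open>Makes limits along this filter unique, so that the \<open>Lim\<close> in
  \<open>spreading_norm\<close> is the limit provided by \<open>good_seq\<close>.\<close>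

lemma increasing_tuples_neq_bot: "increasing_tuples k \<noteq> bot"
  unfolding trivial_limit_def eventually_increasing_tuples
proof clarify
  fix N :: nat assume "\<forall>n. strict_mono_on {..<k} n \<and> (\<forall>i<k. N \<le> n i) \<longrightarrow> False"
  from this[rule_format, of "\<lambda>i. N + i"] show False
    by (auto simp: strict_mono_on_def)
qed

lemma filterlim_increasing_tuples_comp:
  assumes "strict_mono_on {..<k} r" "r ` {..<k} \<subseteq> {..<K}"
  shows "filterlim (\<lambda>m. m \<circ> r) (increasing_tuples k) (increasing_tuples K)"
  unfolding filterlim_iff eventually_increasing_tuples
proof (intro allI impI, elim exE)
  fix P and N :: nat
  assume P: "\<forall>n. strict_mono_on {..<k} n \<and> (\<forall>i<k. N \<le> n i) \<longrightarrow> P n"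
  show "\<exists>N. \<forall>n. strict_mono_on {..<K} n \<and> (\<forall>i<K. N \<le> n i) \<longrightarrow> P (n \<circ> r)"
  proof (intro exI allI impI)
    fix n :: "nat \<Rightarrow> nat"
    assume n: "strict_mono_on {..<K} n \<and> (\<forall>i<K. N \<le> n i)"
    have "strict_mono_on {..<k} (n \<circ> r)"
      using n assms unfolding strict_mono_on_def by (simp add: image_subset_iff)
    moreover have "\<forall>i<k. N \<le> (n \<circ> r) i"
      using n assms by (simp add: image_subset_iff)
    ultimately show "P (n \<circ> r)"
      using P by blast
  qed
qed

lemma spreading_norm_tendsto:
  assumes "good_seq x"
  shows "((\<lambda>n. norm (\<Sum>i<k. a i *\<^sub>R x (n i))) \<longlongrightarrow> spreading_norm x k a) (increasing_tuples k)"
proof -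
  obtain L where L: "((\<lambda>n. norm (\<Sum>i<k. a i *\<^sub>R x (n i))) \<longlongrightarrow> L) (increasing_tuples k)"
    using assms unfolding good_seq_def by blast
  then have "spreading_norm x k a = L"
    unfolding spreading_norm_def using increasing_tuples_neq_bot tendsto_Lim by blast
  then show ?thesis
    using L by simp
qed

text \<open>Placing \<open>a i\<close> at position \<open>r i\<close> and zeros elsewhere gives a
  vector \<open>b\<close> of length \<open>K\<close>. Its norm is a limit over
  \<open>K\<close>-tuples of an expression that sees only the entries selected by \<open>r\<close>,
  and these entries form a \<open>k\<close>-tuple that also tends to infinity.\<close>

lemma spreading_model_spreading:
  assumes "is_spreading_model x e" and r: "strict_mono r"
  shows "norm (\<Sum>i<k. a i *\<^sub>R e (r i)) = norm (\<Sum>i<k. a i *\<^sub>R e i)"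
proof -
  have good: "good_seq x" and e: "\<And>k a. norm (\<Sum>i<k. a i *\<^sub>R e i) = spreading_norm x k a"
    using assms(1) by (auto simp: is_spreading_model_def)
  have "inj r"
    using r by (rule strict_mono_imp_inj_on)
  define K where "K = r k"
  define b where "b j = (if j \<in> r ` {..<k} then a (inv r j) else 0)" for j
  have sub: "r ` {..<k} \<subseteq> {..<K}"
    using r by (auto simp: K_def strict_mono_less)
  \<comment> \<open>Stated for every vector sequence, as it is applied both to \<open>x\<close>
    along a tuple and to \<open>e\<close>.\<close>
  have sum_b: "(\<Sum>j<K. b j *\<^sub>R v j) = (\<Sum>i<k. a i *\<^sub>R v (r i))" for v :: "nat \<Rightarrow> 'c::real_vector"
  proof -
    have "(\<Sum>j<K. b j *\<^sub>R v j) = (\<Sum>j\<in>r ` {..<k}. b j *\<^sub>R v j)"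
      using sub by (intro sum.mono_neutral_right) (auto simp: b_def)
    also have "\<dots> = (\<Sum>i<k. a i *\<^sub>R v (r i))"
      using \<open>inj r\<close> by (subst sum.reindex) (auto simp: b_def inj_on_def)
    finally show ?thesis .
  qed
  have "filterlim (\<lambda>m. m \<circ> r) (increasing_tuples k) (increasing_tuples K)"
    using sub r
    by (intro filterlim_increasing_tuples_comp) (auto simp: strict_mono_on_def strict_mono_def)
  from filterlim_compose[OF spreading_norm_tendsto[OF good] this]
  have "((\<lambda>m. norm (\<Sum>j<K. b j *\<^sub>R x (m j))) \<longlongrightarrow> spreading_norm x k a) (increasing_tuples K)"
    by (simp add: sum_b)
  then have "spreading_norm x K b = spreading_norm x k a"
    using spreading_norm_tendsto[OF good] increasing_tuples_neq_bot tendsto_unique by blast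
  then show ?thesis
    using e[of b K] e[of a k] by (simp add: sum_b)
qed

section \<open>Convex combinations, the shift and its fixed points\<close>

lemma convex_hull_sequenceE:
  fixes e :: "nat \<Rightarrow> 'a::real_vector"
  assumes "y \<in> convex hull (range e)"
  obtains k a where "\<And>i. a i \<ge> 0" "(\<Sum>i<k. a i) = (1::real)" "y = (\<Sum>i<k. a i *\<^sub>R e i)"
proof -
  obtain S u where "finite S" "S \<subseteq> range e" and u: "\<forall>v\<in>S. 0 \<le> u v" "sum u S = 1"
    and y: "(\<Sum>v\<in>S. u v *\<^sub>R v) = y"
    using assms unfolding convex_hull_explicit by blast
  \<comment> \<open>One index is chosen for each point of \<open>S\<close>, since \<open>e\<close>
    may repeat values.\<close>
  then obtain I where I: "finite I" "inj_on e I" "S = e ` I"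
    by (auto simp: subset_image_inj finite_image_iff)
  obtain k where k: "I \<subseteq> {..<k}"
    using finite_nat_iff_bounded I(1) by blast
  let ?a = "\<lambda>i. if i \<in> I then u (e i) else 0"
  show ?thesis
  proof
    show "?a i \<ge> 0" for i
      using u I by simp
    have "(\<Sum>i<k. ?a i) = (\<Sum>i\<in>I. u (e i))"
      using k by (intro sum.mono_neutral_cong_right) auto
    then show "(\<Sum>i<k. ?a i) = 1"
      using u I by (simp add: sum.reindex)
    have "(\<Sum>i<k. ?a i *\<^sub>R e i) = (\<Sum>i\<in>I. u (e i) *\<^sub>R e i)"
      using k by (intro sum.mono_neutral_cong_right) auto
    then show "y = (\<Sum>i<k. ?a i *\<^sub>R e i)"
      using y I by (simp add: sum.reindex)
  qed
qed

lemma shift_basis: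
  assumes "is_shift e T"
  shows "T (e i) = e (Suc i)"
proof -
  let ?a = "\<lambda>j. if j = i then 1 else 0 :: real"
  have "T (\<Sum>j<Suc i. ?a j *\<^sub>R e j) = (\<Sum>j=1..Suc i. ?a (j - 1) *\<^sub>R e j)"
    using assms by (simp only: is_shift_def)
  moreover have "(\<Sum>j=1..Suc i. ?a (j - 1) *\<^sub>R e j) = (\<Sum>j\<le>i. ?a j *\<^sub>R e (Suc j))"
    by (simp add: sum.atLeast_Suc_atMost_Suc_shift atMost_atLeast0 del: sum.cl_ivl_Suc)
  ultimately show ?thesis
    by (simp add: if_distrib[of "\<lambda>c. c *\<^sub>R _"] sum.delta lessThan_Suc_atMost cong: if_cong)
qed

text \<open>Each application of \<open>T\<close> raises all indices by one, fixes \<open>z\<close>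
  and preserves distances.\<close>

lemma fixed_point_dist_shifted_sum:
  assumes "is_shift e T" "T z = z"
  shows "norm ((\<Sum>i<k. a i *\<^sub>R e (m + i)) - z) = norm ((\<Sum>i<k. a i *\<^sub>R e i) - z)"
proof (induction m)
  case (Suc m)
  have "linear T"
    using assms by (simp add: is_shift_def)
  then have "T ((\<Sum>i<k. a i *\<^sub>R e (m + i)) - z) = (\<Sum>i<k. a i *\<^sub>R e (Suc m + i)) - z"
    by (simp add: linear_diff[OF \<open>linear T\<close>] linear_sum[OF \<open>linear T\<close>] linear_scale[OF \<open>linear T\<close>]
        shift_basis[OF assms(1)] \<open>T z = z\<close>)
  moreover have "norm (T w) = norm w" for w
    using assms(1) by (simp add: is_shift_def)
  ultimately show ?case
    using Suc by metis
qed simp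

lemma sum_lessThan_add:
  fixes k l :: nat
  shows "(\<Sum>i<k + l. g i) = (\<Sum>i<k. g i) + (\<Sum>i<l. g (k + i) :: 'a::comm_monoid_add)"
  by (induction l) (simp_all add: add.assoc)

lemma fixed_point_dist_subsequence_sum:
  assumes "is_spreading_model x e" "is_shift e T" "T z = z" and r: "strict_mono r"
  shows "norm ((\<Sum>i<k. a i *\<^sub>R e (r i)) - z) \<le> 3 * norm ((\<Sum>i<k. a i *\<^sub>R e i) - z)"
proof -
  let ?s = "\<lambda>m. \<Sum>i<k. a i *\<^sub>R e (m + i)"
  \<comment> \<open>The coefficients \<open>(a, - a)\<close> turn the difference of two blocks into
    one sum of length \<open>k + k\<close>. The indices \<open>r'\<close> follow \<open>r\<close> on
    the first block and run consecutively from \<open>r k\<close> afterwards.\<close>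
  define b where "b i = (if i < k then a i else - a (i - k))" for i
  define r' where "r' i = (if i < k then r i else r k + (i - k))" for i
  have "r i < r k + j - k" if "i < k" "\<not> j < k" for i j
    using strict_monoD[OF r that(1)] that(2) by simp
  then have "strict_mono r'"
    using strict_monoD[OF r] by (auto simp: strict_mono_def r'_def)
  have split: "(\<Sum>i<k + k. b i *\<^sub>R v i) = (\<Sum>i<k. a i *\<^sub>R v i) - (\<Sum>i<k. a i *\<^sub>R v (k + i))"
    for v :: "nat \<Rightarrow> 'b"
    by (simp add: sum_lessThan_add b_def sum_negf)
  have "norm ((\<Sum>i<k. a i *\<^sub>R e (r i)) - ?s (r k)) = norm (?s 0 - ?s k)"
    using spreading_model_spreading[OF assms(1) \<open>strict_mono r'\<close>, of b "k + k"]
    by (simp add: split split[of "\<lambda>i. e (r' i)"] r'_def)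
  also have "\<dots> \<le> norm (?s 0 - z) + norm (?s k - z)"
    using norm_triangle_ineq4[of "?s 0 - z" "?s k - z"] by simp
  finally have "norm ((\<Sum>i<k. a i *\<^sub>R e (r i)) - ?s (r k)) \<le> 2 * norm (?s 0 - z)"
    using fixed_point_dist_shifted_sum[OF assms(2,3), of a k k] by simp
  then show ?thesis
    using norm_triangle_ineq[of "(\<Sum>i<k. a i *\<^sub>R e (r i)) - ?s (r k)" "?s (r k) - z"]
      fixed_point_dist_shifted_sum[OF assms(2,3), of a "r k" k]
    by simp
qed

text \<open>If \<open>f\<close> exceeded \<open>f z + \<delta>\<close> along a subsequence, so would
  it at all convex combinations of that subsequence, yet some of these are arbitrarily close to
  \<open>z\<close>. The one-sided form suffices, as it can be applied to \<open>- f\<close>.\<close>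

lemma eventually_less_fixed_point:
  fixes f :: "'z::banach \<Rightarrow>\<^sub>L real"
  assumes "is_spreading_model x e" "is_shift e T" "T z = z"
    and z: "z \<in> closure (convex hull (range e))" and "\<delta> > 0"
  shows "eventually (\<lambda>n. f (e n) < f z + \<delta>) sequentially"
proof (rule ccontr)
  assume "\<not> eventually (\<lambda>n. f (e n) < f z + \<delta>) sequentially"
  then have "infinite {n. f z + \<delta> \<le> f (e n)}"
    by (simp add: not_eventually not_less frequently_cofinite flip: cofinite_eq_sequentially)
  then obtain r :: "nat \<Rightarrow> nat" where r: "strict_mono r" "\<And>n. f z + \<delta> \<le> f (e (r n))"
    using infinite_enumerate by blast
  \<comment> \<open>The 3 cancels the factor in the distance bound for \<open>w\<close>; adding 1 to
    \<open>norm f\<close> keeps the denominator positive when \<open>f = 0\<close>.\<close>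
  define \<epsilon> where "\<epsilon> = \<delta> / (3 * (norm f + 1))"
  have "norm f + 1 > 0"
    using norm_ge_zero[of f] by linarith
  then have "\<epsilon> > 0"
    using \<open>\<delta> > 0\<close> by (simp add: \<epsilon>_def)
  then obtain y where "y \<in> convex hull (range e)" and y: "norm (y - z) < \<epsilon>"
    using z by (auto simp: closure_approachable dist_norm)
  then obtain a k where a: "\<And>i. a i \<ge> 0" "(\<Sum>i<k. a i) = 1" and "y = (\<Sum>i<k. a i *\<^sub>R e i)"
    using convex_hull_sequenceE[of y e] by blast
  define w where "w = (\<Sum>i<k. a i *\<^sub>R e (r i))"
  have w: "norm (w - z) < 3 * \<epsilon>"
    using fixed_point_dist_subsequence_sum[OF assms(1-3) r(1), of a k] y
    by (simp add: w_def \<open>y = _\<close>)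
  have "f z + \<delta> = (\<Sum>i<k. a i * (f z + \<delta>))"
    using a(2) by (simp flip: sum_distrib_right)
  also have "\<dots> \<le> (\<Sum>i<k. a i * f (e (r i)))"
    using a(1) r(2) by (intro sum_mono mult_left_mono)
  also have "\<dots> = f w"
    by (simp add: w_def blinfun.sum_right blinfun.scaleR_right)
  finally have "\<delta> \<le> f (w - z)"
    by (simp add: blinfun.diff_right)
  also have "\<dots> \<le> norm f * norm (w - z)"
    using norm_blinfun[of f "w - z"] by simp
  also have "\<dots> \<le> (norm f + 1) * norm (w - z)"
    by (simp add: mult_right_mono)
  also have "\<dots> < (norm f + 1) * (3 * \<epsilon>)"
    using w \<open>norm f + 1 > 0\<close> by (rule mult_strict_left_mono)
  also have "\<dots> = \<delta>"
    using \<open>norm f + 1 > 0\<close> by (simp add: \<epsilon>_def field_simps)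
  finally show False
    by simp
qed

section \<open>Fixed points of the shift and weak convergence of the basis\<close>

theorem proposition2p1:
  fixes x :: "nat \<Rightarrow> 'a::banach"
    and e :: "nat \<Rightarrow> 'z::banach"
    and T :: "'z \<Rightarrow> 'z"
  assumes "is_spreading_model x e"
    and "is_shift e T"
  shows "(\<exists>z \<in> closure (convex hull (range e)). T z = z) \<longleftrightarrow> weakly_convergent e"
proof
  assume "\<exists>z \<in> closure (convex hull (range e)). T z = z"
  then obtain z where z: "z \<in> closure (convex hull (range e))" "T z = z"
    by blast
  have "(\<lambda>n. f (e n)) \<longlonglongrightarrow> f z" for f :: "'z \<Rightarrow>\<^sub>L real"
  proof (rule order_tendstoI)
    fix b assume "f z < b"
    then show "eventually (\<lambda>n. f (e n) < b) sequentially"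
      using eventually_less_fixed_point[OF assms z(2,1), of "b - f z" f] by simp
  next
    fix b assume "b < f z"
    then show "eventually (\<lambda>n. b < f (e n)) sequentially"
      using eventually_less_fixed_point[OF assms z(2,1), of "f z - b" "- f"]
      by (simp add: blinfun.minus_left)
  qed
  then show "weakly_convergent e"
    unfolding weakly_convergent_def by blast
next
  assume "weakly_convergent e"
  then obtain l where l: "\<And>f :: 'z \<Rightarrow>\<^sub>L real. (\<lambda>n. f (e n)) \<longlonglongrightarrow> f l"
    unfolding weakly_convergent_def by blast
  have "bounded_linear T"
    using assms(2) by (auto simp: is_shift_def bounded_linear_def bounded_linear_axioms_def
        intro!: exI[of _ 1])
  have "T l = l"
  proof (rule blinfun_separates_points)
    fix f :: "'z \<Rightarrow>\<^sub>L real"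
    \<comment> \<open>Composing \<open>f\<close> with \<open>T\<close> gives another bounded
      functional, so \<open>T\<close> carries the weak limit along; but the image of
      \<open>e\<close> under \<open>T\<close> is just its tail, with limit \<open>l\<close>.\<close>
    have "(\<lambda>n. f (T (e n))) \<longlonglongrightarrow> f (T l)"
      using l[of "f o\<^sub>L Blinfun T"] by (simp add: bounded_linear_Blinfun_apply[OF \<open>bounded_linear T\<close>])
    moreover have "(\<lambda>n. f (T (e n))) \<longlonglongrightarrow> f l"
      using l[of f, THEN LIMSEQ_Suc] by (simp add: shift_basis[OF assms(2)])
    ultimately show "f (T l) = f l"
      by (rule LIMSEQ_unique)
  qed
  then show "\<exists>z \<in> closure (convex hull (range e)). T z = z"
    using Mazur_weak_limit[OF l] by blast
qed

end
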